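(* For every integer $d \geq 1$, the layer number of the $d$-dimensional grid $[n]^d$ satisfies $\tau([n]^d) \geq \Omega\left(n^{\frac{2d}{d+1}}\right)$; that is, for every $d\ge 1$ there is a constant $c_d > 0$ depending only on $d$ such that $\tau([n]^d) \geq c_d\, n^{\frac{2d}{d+1}}$ for all sufficiently large positive integers $n$.
   Context: For a positive integer $n$, $[n]^d = \{1,\ldots,n\}^d \subset \mathbb{R}^d$. Given a finite point set $X \subset \mathbb{R}^d$, the peeling process is defined by $X_0 = X$ and $X_i = X_{i-1} \setminus \mathrm{ext}(X_{i-1})$ for $i \geq 1$, where $\mathrm{ext}(Y)$ is the set of extreme points of $Y$, i.e. the set of vertices of the convex hull of $Y$. The layer number $\tau(X)$ is the smallest index $i$ for which $X_i = \emptyset$. Asymptotic notation is for fixed $d$ as $n \to \infty$, with implied constants depending on $d$. *)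

theory Defs
  imports "HOL-Analysis.Analysis"
begin

definition grid :: "nat \<Rightarrow> (real ^ 'd::finite) set" where
  "grid n = {x. \<forall>i. \<exists>k::nat. 1 \<le> k \<and> k \<le> n \<and> x $ i = real k}"

definition ext :: "'a::real_vector set \<Rightarrow> 'a set" where
  "ext Y = {x. x extreme_point_of (convex hull Y)}"

fun peel :: "'a::real_vector set \<Rightarrow> nat \<Rightarrow> 'a set" where
  "peel X 0 = X"
| "peel X (Suc i) = peel X i - ext (peel X i)"

text \<open>The least index is meaningful only if peeling terminates, which it does for
  finite sets: see \<open>peel_layer_number\<close> below.\<close>

definition layer_number :: "'a::real_vector set \<Rightarrow> nat" where
  "layer_number X = (LEAST i. peel X i = {})"

lemma ext_subset: "ext Y \<subseteq> Y"
  by (auto simp: ext_def extreme_point_of_convex_hull)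

lemma ext_nonempty:
  fixes Y :: "'a::euclidean_space set"
  assumes "finite Y" "Y \<noteq> {}"
  shows "ext Y \<noteq> {}"
proof -
  have "compact (convex hull Y)"
    using assms(1) by (simp add: finite_imp_compact_convex_hull)
  moreover have "convex hull Y \<noteq> {}"
    using assms(2) by simp
  ultimately show ?thesis
    unfolding ext_def using extreme_point_exists_convex[of "convex hull Y"] by blast
qed

lemma finite_peel: "finite X \<Longrightarrow> finite (peel X i)"
  by (induction i) auto

lemma peel_layer_number:
  fixes X :: "'a::euclidean_space set"
  assumes "finite X"
  shows "peel X (layer_number X) = {}"
proof -
  have "peel X i = {} \<or> card (peel X i) + i \<le> card X" for i
  proof (induction i)
    case (Suc i)
    show ?case
    proof (cases "peel X i = {}")
      case False
      have "peel X (Suc i) \<subset> peel X i"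
        using ext_nonempty[OF finite_peel[OF assms] False] ext_subset[of "peel X i"] by auto
      then have "card (peel X (Suc i)) < card (peel X i)"
        by (rule psubset_card_mono[OF finite_peel[OF assms]])
      then show ?thesis using Suc False by linarith
    qed simp
  qed simp
  from this[of "Suc (card X)"] have "\<exists>i. peel X i = {}" by fastforce
  then show ?thesis unfolding layer_number_def by (rule LeastI_ex)
qed

lemma finite_grid: "finite (grid n :: (real ^ 'd::finite) set)"
proof -
  have "grid n \<subseteq> vec_lambda ` (UNIV \<rightarrow>\<^sub>E (real ` {1..n}) :: ('d \<Rightarrow> real) set)"
  proof
    fix x :: "real ^ 'd" assume "x \<in> grid n"
    then have "vec_nth x \<in> UNIV \<rightarrow>\<^sub>E real ` {1..n}"
      by (fastforce simp: grid_def)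
    then show "x \<in> vec_lambda ` (UNIV \<rightarrow>\<^sub>E (real ` {1..n}) :: ('d \<Rightarrow> real) set)"
      by (metis imageI vec_lambda_eta)
  qed
  moreover have "finite (vec_lambda ` (UNIV \<rightarrow>\<^sub>E (real ` {1..n}) :: ('d \<Rightarrow> real) set))"
    by (intro finite_imageI finite_PiE) auto
  ultimately show ?thesis by (rule finite_subset)
qed

end

theory Submission
  imports Defs
begin

text \<open>
  Let \<open>c\<close> be an integer point near the centre of the grid. If the current set contains all
  integer points with \<open>\<parallel>x - c\<parallel>\<^sup>2 \<le> s\<close>, then no integer point with \<open>\<parallel>x - c\<parallel>\<^sup>2 \<le> s - D\<close> is extreme,
  where \<open>D\<close> is of order \<open>n powr (2 / (d + 1))\<close>: by the pigeonhole principle there is an integer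
  vector \<open>v \<noteq> 0\<close> with \<open>2 \<bar>(x - c) \<bullet> v\<bar> + \<parallel>v\<parallel>\<^sup>2 \<le> D\<close>, so \<open>x\<close> is the midpoint of \<open>x - v\<close> and \<open>x + v\<close>,
  which both survive. Hence each step lowers the squared radius by at most \<open>D\<close>, and of the order of
  \<open>n\<^sup>2 / D\<close> steps are needed.
\<close>

text \<open>The lattice Z^d, left unbounded so that \<open>x + v\<close> and \<open>x - v\<close>
  remain in it without boundary checks; that points lie in the grid is deduced from their distance
  to the centre.\<close>

definition integer_vectors :: "(real ^ 'd) set" where
  "integer_vectors = {x. \<forall>i. x $ i \<in> \<int>}"

lemma integer_vectors_add:
  "x \<in> integer_vectors \<Longrightarrow> y \<in> integer_vectors \<Longrightarrow> x + y \<in> integer_vectors"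
  by (simp add: integer_vectors_def)

lemma integer_vectors_diff:
  "x \<in> integer_vectors \<Longrightarrow> y \<in> integer_vectors \<Longrightarrow> x - y \<in> integer_vectors"
  by (simp add: integer_vectors_def)

text \<open>Pigeonhole on the box \<open>{0..K}^d\<close>: the inner products of its vectors with
  \<open>p\<close> have absolute value at most \<open>M * K^2\<close>, so after division by
  \<open>K^2\<close> their floors take at most \<open>2 * M + 1\<close> values. Two of the
  \<open>(K + 1)^d\<close> vectors share a floor, and \<open>v\<close> is their difference. Interval
  length \<open>K^2\<close> is chosen to have the same order as the bound on the squared norm of
  \<open>v\<close>.\<close>

lemma short_almost_orthogonal_vector:
  fixes p :: "real ^ 'd::finite" and K M :: nat
  assumes p: "\<And>i. \<bar>p $ i\<bar> \<le> R"
    and K: "K > 0"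
    and M: "real CARD('d) * R \<le> real M * real K"
    and less: "2 * M + 1 < (K + 1) ^ CARD('d)"
  obtains v where "v \<in> integer_vectors" "v \<noteq> 0" "\<bar>p \<bullet> v\<bar> \<le> (real K)\<^sup>2"
    "(norm v)\<^sup>2 \<le> real CARD('d) * (real K)\<^sup>2"
proof -
  define W :: "('d \<Rightarrow> nat) set" where "W = UNIV \<rightarrow>\<^sub>E {0..K}"
  define g :: "('d \<Rightarrow> nat) \<Rightarrow> real ^ 'd" where "g w = (\<chi> i. real (w i))" for w
  define f where "f w = \<lfloor>(p \<bullet> g w) / (real K)\<^sup>2\<rfloor>" for w
  have W: "w i \<le> K" if "w \<in> W" for w i
    using that by (auto simp: W_def PiE_iff)
  have cW: "card W = (K + 1) ^ CARD('d)"
    by (simp add: W_def card_PiE)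
  have "f ` W \<subseteq> {- int M..int M}"
  proof (rule image_subsetI)
    fix w assume w: "w \<in> W"
    have "\<bar>p \<bullet> g w\<bar> \<le> (\<Sum>i\<in>UNIV. \<bar>p $ i * real (w i)\<bar>)"
      by (simp add: inner_vec_def g_def sum_abs)
    also have "\<dots> \<le> (\<Sum>i\<in>(UNIV :: 'd set). R * real K)"
      unfolding abs_mult using p W[OF w] order_trans[OF abs_ge_zero p]
      by (intro sum_mono mult_mono) auto
    also have "\<dots> = (real CARD('d) * R) * real K"
      by simp
    also have "\<dots> \<le> (real M * real K) * real K"
      by (intro mult_right_mono M) simp
    finally have "\<bar>(p \<bullet> g w) / (real K)\<^sup>2\<bar> \<le> real M"
      using K by (simp add: divide_simps power2_eq_square mult_ac)
    then show "f w \<in> {- int M..int M}"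
      unfolding f_def atLeastAtMost_iff by linarith
  qed
  then have "card (f ` W) \<le> card {- int M..int M}"
    by (intro card_mono) auto
  also have "\<dots> = 2 * M + 1"
    by simp
  finally have "\<not> inj_on f W"
    using less cW card_image[of f W] by linarith
  then obtain a b where ab: "a \<in> W" "b \<in> W" "a \<noteq> b" "f a = f b"
    by (auto simp: inj_on_def)
  show ?thesis
  proof
    show "g a - g b \<in> integer_vectors"
      by (auto simp: integer_vectors_def g_def)
    show "g a - g b \<noteq> 0"
      using \<open>a \<noteq> b\<close> by (auto simp: g_def vec_eq_iff fun_eq_iff)
    have "\<bar>(p \<bullet> g a) / (real K)\<^sup>2 - (p \<bullet> g b) / (real K)\<^sup>2\<bar> \<le> 1"
      using \<open>f a = f b\<close> unfolding f_def by linarith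
    then show "\<bar>p \<bullet> (g a - g b)\<bar> \<le> (real K)\<^sup>2"
      using K by (simp add: inner_diff_right divide_simps flip: diff_divide_distrib)
    have "(norm (g a - g b))\<^sup>2 = (\<Sum>i\<in>UNIV. (real (a i) - real (b i))\<^sup>2)"
      unfolding power2_norm_eq_inner by (simp add: inner_vec_def g_def power2_eq_square)
    also have "\<dots> \<le> (\<Sum>i\<in>(UNIV :: 'd set). (real K)\<^sup>2)"
    proof (rule sum_mono)
      fix i
      have "\<bar>real (a i) - real (b i)\<bar> \<le> \<bar>real K\<bar>"
        using W[OF ab(1), of i] W[OF ab(2), of i] by linarith
      then show "(real (a i) - real (b i))\<^sup>2 \<le> (real K)\<^sup>2"
        by (simp only: abs_le_square_iff)
    qed
    finally show "(norm (g a - g b))\<^sup>2 \<le> real CARD('d) * (real K)\<^sup>2"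
      by simp
  qed
qed

lemma not_ext_midpoint:
  assumes "x + v \<in> Y" "x - v \<in> Y" "v \<noteq> 0"
  shows "x \<notin> ext Y"
proof
  assume "x \<in> ext Y"
  then have "x extreme_point_of (convex hull Y)"
    by (simp add: ext_def)
  moreover have "midpoint (x + v) (x - v) = x"
    by (simp add: midpoint_def flip: scaleR_2)
  moreover have "x + v \<noteq> x - v"
  proof
    assume "x + v = x - v"
    then have "2 *\<^sub>R v = 0"
      by (simp add: scaleR_2 eq_neg_iff_add_eq_0)
    with \<open>v \<noteq> 0\<close> show False
      by simp
  qed
  ultimately show False
    using assms hull_inc[of _ Y convex] midpoint_in_open_segment[of "x + v" "x - v"]
    unfolding extreme_point_of_def by metis
qed

text \<open>Induction on \<open>i\<close>. One round costs at most \<open>(d + 2) * K^2\<close> in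
  squared radius: \<open>2 * K^2\<close> from the inner product and \<open>d * K^2\<close> from the
  squared norm of \<open>v\<close>.\<close>

lemma integer_ball_subset_peel:
  fixes c :: "real ^ 'd::finite" and K M i :: nat
  assumes c: "c \<in> integer_vectors"
    and ball: "\<And>x. x \<in> integer_vectors \<Longrightarrow> norm (x - c) \<le> R \<Longrightarrow> x \<in> X"
    and R: "R \<ge> 0"
    and K: "K > 0"
    and M: "real CARD('d) * R \<le> real M * real K"
    and less: "2 * M + 1 < (K + 1) ^ CARD('d)"
    and x: "x \<in> integer_vectors"
    and norm_x: "(norm (x - c))\<^sup>2 + real i * ((real CARD('d) + 2) * (real K)\<^sup>2) \<le> R\<^sup>2"
  shows "x \<in> peel X i"
  using x norm_x
proof (induction i arbitrary: x)
  case 0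
  then show ?case
    using R by (auto intro!: ball power2_le_imp_le)
next
  case (Suc i)
  define D where "D = (real CARD('d) + 2) * (real K)\<^sup>2"
  have D: "D \<ge> 0"
    by (simp add: D_def)
  have x: "(norm (x - c))\<^sup>2 + D + real i * D \<le> R\<^sup>2"
    using Suc.prems(2) by (simp add: D_def algebra_simps)
  moreover have "0 \<le> real i * D"
    using D by simp
  ultimately have "(norm (x - c))\<^sup>2 \<le> R\<^sup>2"
    using D by linarith
  \<comment> \<open>The initial radius bounds the coordinates in every round, so the same
    \<open>K\<close> and \<open>M\<close> serve throughout.\<close>
  then have "norm (x - c) \<le> R"
    by (rule power2_le_imp_le) fact
  then have "\<bar>(x - c) $ j\<bar> \<le> R" for j
    using component_le_norm_cart order_trans by blast
  then obtain v where v: "v \<in> integer_vectors" "v \<noteq> 0" "\<bar>(x - c) \<bullet> v\<bar> \<le> (real K)\<^sup>2"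
    "(norm v)\<^sup>2 \<le> real CARD('d) * (real K)\<^sup>2"
    using short_almost_orthogonal_vector K M less by metis
  have small: "2 * \<bar>(x - c) \<bullet> v\<bar> + (norm v)\<^sup>2 \<le> D"
    using v(3,4) by (simp add: D_def algebra_simps)
  have "(norm (x + v - c))\<^sup>2 = (norm (x - c))\<^sup>2 + 2 * ((x - c) \<bullet> v) + (norm v)\<^sup>2"
    by (simp add: power2_norm_eq_inner inner_commute algebra_simps)
  then have "(norm (x + v - c))\<^sup>2 + real i * D \<le> R\<^sup>2"
    using x small by linarith
  then have plus: "x + v \<in> peel X i"
    unfolding D_def by (rule Suc.IH[OF integer_vectors_add[OF Suc.prems(1) v(1)]])
  have "(norm (x - v - c))\<^sup>2 = (norm (x - c))\<^sup>2 - 2 * ((x - c) \<bullet> v) + (norm v)\<^sup>2"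
    by (simp add: power2_norm_eq_inner inner_commute algebra_simps)
  then have "(norm (x - v - c))\<^sup>2 + real i * D \<le> R\<^sup>2"
    using x small by linarith
  then have minus: "x - v \<in> peel X i"
    unfolding D_def by (rule Suc.IH[OF integer_vectors_diff[OF Suc.prems(1) v(1)]])
  have "x \<in> peel X i"
    using x D by (intro Suc.IH Suc.prems(1)) (simp flip: D_def)
  then show ?case
    using not_ext_midpoint[OF plus minus v(2)] by simp
qed

text \<open>The ball argument with \<open>K = 3 * t\<close> and \<open>M = t^d\<close>. In the
  constant, 144 = 16 * 9, where 16 comes from \<open>R \<ge> n / 4\<close> and 9 from the square of
  \<open>K\<close>.\<close>

lemma layer_number_grid_lower:
  fixes n t :: nat
  assumes n: "n \<ge> 4"
    and t: "real CARD('d::finite) * real n \<le> real t ^ (CARD('d) + 1)"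
  shows "(real n)\<^sup>2 \<le> 144 * (real CARD('d) + 2) * (real t)\<^sup>2
           * real (layer_number (grid n :: (real ^ 'd) set))"
proof -
  let ?X = "grid n :: (real ^ 'd) set"
  \<comment> \<open>With \<open>R = m - 1\<close> the coordinates of the ball range within
    \<open>1\<close> and \<open>2 * m - 1\<close>, which is at most \<open>n\<close> for either
    parity.\<close>
  define m where "m = (n + 1) div 2"
  define R where "R = real m - 1"
  define c :: "real ^ 'd" where "c = (\<chi> i. real m)"
  have m: "2 * m \<le> n + 1" "n \<le> 2 * m"
    by (auto simp: m_def)
  have R: "real n / 4 \<le> R" "R \<le> real n"
    using m n by (auto simp: R_def)
  have "t > 0"
  proof (rule ccontr)
    assume "\<not> t > 0"
    then have "real CARD('d) * real n \<le> 0"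
      using t by simp
    then show False
      using n by (simp add: mult_le_0_iff)
  qed
  have ball: "x \<in> ?X" if x: "x \<in> integer_vectors" "norm (x - c) \<le> R" for x
    unfolding grid_def
  proof (intro CollectI allI)
    fix i
    obtain k :: int where k: "x $ i = of_int k"
      using x(1) by (auto simp: integer_vectors_def Ints_def)
    have "\<bar>x $ i - real m\<bar> \<le> R"
      using order_trans[OF component_le_norm_cart x(2), of i] by (simp add: c_def)
    then have "1 \<le> k" "k \<le> int n"
      using m unfolding k R_def by linarith+
    then show "\<exists>k::nat. 1 \<le> k \<and> k \<le> n \<and> x $ i = real k"
      using k by (intro exI[of _ "nat k"]) auto
  qed
  have M: "real CARD('d) * R \<le> real (t ^ CARD('d)) * real (3 * t)"
  proof -
    have "real CARD('d) * R \<le> real CARD('d) * real n"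
      using R by (intro mult_left_mono) auto
    also have "\<dots> \<le> real t ^ (CARD('d) + 1)"
      by (rule t)
    also have "\<dots> \<le> real (t ^ CARD('d)) * real (3 * t)"
      by simp
    finally show ?thesis .
  qed
  \<comment> \<open>The factor 3 in \<open>K\<close> is for dimension one, where a factor 2 would
    give equality.\<close>
  have less: "2 * t ^ CARD('d) + 1 < (3 * t + 1) ^ CARD('d)"
  proof -
    have "2 * t ^ CARD('d) + 1 < 3 * t ^ CARD('d) + 1"
      using \<open>t > 0\<close> by simp
    also have "\<dots> \<le> 3 ^ CARD('d) * t ^ CARD('d) + 1"
      using power_increasing[of 1 "CARD('d)" "3::nat"]
      by (intro add_right_mono mult_right_mono) (simp_all add: Suc_le_eq)
    also have "\<dots> = (3 * t) ^ CARD('d) + 1"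
      by (simp add: power_mult_distrib)
    also have "\<dots> \<le> (3 * t + 1) ^ CARD('d)"
      using power_strict_mono[of "3 * t" "3 * t + 1" "CARD('d)"] by simp
    finally show ?thesis .
  qed
  have c: "c \<in> integer_vectors"
    by (simp add: integer_vectors_def c_def)
  define D where "D = (real CARD('d) + 2) * (real (3 * t))\<^sup>2"
  \<comment> \<open>The centre is at distance 0, so it survives \<open>i\<close> rounds whenever
    \<open>i * D \<le> R^2\<close>. As nothing is left after the last round, this inequality fails
    there.\<close>
  have "c \<notin> peel ?X (layer_number ?X)"
    by (simp add: peel_layer_number finite_grid)
  then have "\<not> (norm (c - c))\<^sup>2 + real (layer_number ?X) * D \<le> R\<^sup>2"
    using integer_ball_subset_peel[OF c ball _ _ M less c] R \<open>t > 0\<close>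
    unfolding D_def by fastforce
  then have "R\<^sup>2 \<le> real (layer_number ?X) * D"
    by simp
  moreover have "(real n / 4)\<^sup>2 \<le> R\<^sup>2"
    using R by (intro power_mono) auto
  ultimately have "(real n)\<^sup>2 \<le> 16 * (real (layer_number ?X) * D)"
    by (simp add: power_divide)
  then show ?thesis
    by (simp add: D_def power_mult_distrib algebra_simps)
qed

theorem theorem1:
  "\<exists>c::real. c > 0 \<and>
     (\<forall>\<^sub>F n in sequentially.
        real (layer_number (grid n :: (real ^ 'd::finite) set))
          \<ge> c * real n powr (2 * real CARD('d) / (real CARD('d) + 1)))"
proof -
  define d where "d = real CARD('d)"
  have d: "d \<ge> 1"
    by (simp add: d_def Suc_le_eq)
  \<comment> \<open>Here 576 = 144 * 4, the 4 coming from the square of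
    \<open>t \<le> 2 * a\<close>.\<close>
  define C where "C = 576 * (d + 2) * d powr (2 / (d + 1))"
  have C: "C > 0"
    using d by (simp add: C_def)
  have "1 / C * real n powr (2 * d / (d + 1)) \<le> real (layer_number (grid n :: (real ^ 'd) set))"
    (is "_ \<le> ?L") if n: "n \<ge> 4" for n
  proof -
    \<comment> \<open>The real solution of \<open>a^(d + 1) = d * n\<close>, the smallest value that
      \<open>t\<close> may take. Rounding up at most doubles it because
      \<open>a \<ge> 1\<close>.\<close>
    define a where "a = (d * real n) powr (1 / (d + 1))"
    define t where "t = nat \<lceil>a\<rceil>"
    have dn: "d * real n \<ge> 1"
      using d n mult_mono[of 1 d 1 "real n"] by simp
    then have a: "a \<ge> 1"
      using d by (simp add: a_def ge_one_powr_ge_zero)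
    have t: "a \<le> real t" "real t \<le> 2 * a"
      using a by (auto simp: t_def) linarith+
    have "a ^ (CARD('d) + 1) = d * real n"
    proof -
      have "a ^ (CARD('d) + 1) = a powr (d + 1)"
        using a powr_realpow[of a "CARD('d) + 1"] by (simp add: d_def add.commute)
      then show ?thesis
        using dn d by (simp add: a_def powr_powr)
    qed
    moreover have "a ^ (CARD('d) + 1) \<le> real t ^ (CARD('d) + 1)"
      using a t by (intro power_mono) auto
    ultimately have "(real n)\<^sup>2 \<le> 144 * (d + 2) * (real t)\<^sup>2 * ?L"
      using layer_number_grid_lower[OF n, where 'd = 'd] by (simp add: d_def)
    also have "\<dots> \<le> 144 * (d + 2) * (2 * a)\<^sup>2 * ?L"
      using t d by (intro mult_right_mono mult_left_mono power_mono) auto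
    also have "a\<^sup>2 = d powr (2 / (d + 1)) * real n powr (2 / (d + 1))"
      using d n by (simp add: a_def powr_mult power_mult_distrib powr_power)
    then have "144 * (d + 2) * (2 * a)\<^sup>2 * ?L = C * real n powr (2 / (d + 1)) * ?L"
      by (simp add: C_def power_mult_distrib)
    finally have "(real n)\<^sup>2 \<le> C * real n powr (2 / (d + 1)) * ?L" .
    \<comment> \<open>Splitting off the power of \<open>n\<close> contained in \<open>a^2\<close>
      leaves exactly the claimed exponent.\<close>
    moreover have "(real n)\<^sup>2 = real n powr (2 * d / (d + 1)) * real n powr (2 / (d + 1))"
    proof -
      have "2 * d / (d + 1) + 2 / (d + 1) = 2"
        using d by (simp add: divide_simps flip: add_divide_distrib)
      then show ?thesis
        using n by (simp flip: powr_add powr_numeral)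
    qed
    ultimately have "real n powr (2 * d / (d + 1)) \<le> C * ?L"
      using n by (simp add: mult_ac)
    then show ?thesis
      using C by (simp add: field_simps)
  qed
  then show ?thesis
    using C unfolding d_def
    by (intro exI[of _ "1 / C"] conjI eventually_sequentiallyI[of 4]) auto
qed

end
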